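(* Let $1\le n\le\omega$. (a) If $\mathcal A$ is a maximal antichain in $\langle\mathbb P(\mathbb Q),\subset\rangle$, then $\mathcal B=\{n\times A:A\in\mathcal A\}$ is a maximal antichain in $\langle\mathbb P(\mathbb C_n),\subset\rangle$ and $|\mathcal A|=|\mathcal B|$. (b) The poset $\langle\mathbb P(\mathbb C_n),\subset\rangle$ contains maximal antichains of size $\aleph_0$ and maximal antichains of size $2^{\aleph_0}$.
   Context: $\mathbb C_n=n\times\mathbb Q$ is ordered by $\langle i_1,q_1\rangle<\langle i_2,q_2\rangle$ iff $q_1<_{\mathbb Q}q_2$. For a partial order $\mathbb X$, $\mathbb P(\mathbb X)$ is the set of subsets of its domain whose induced order is isomorphic to $\mathbb X$, ordered by inclusion. Two elements are compatible iff they have a common lower bound in the poset; an antichain is a set of pairwise incompatible elements, maximal iff every element is compatible with some member. *)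

theory Defs
  imports Complex_Main "HOL-Library.Extended_Nat" "HOL-Library.Equipollence"
begin

text \<open>A partial order is given by its domain \<open>X\<close> together with its strict order \<open>lt\<close>.
  Order isomorphisms must both preserve and reflect \<open>lt\<close>, since \<open>lt\<close> need not be linear.\<close>

definition order_iso ::
    "'a set \<Rightarrow> ('a \<Rightarrow> 'a \<Rightarrow> bool) \<Rightarrow> 'b set \<Rightarrow> ('b \<Rightarrow> 'b \<Rightarrow> bool) \<Rightarrow> ('a \<Rightarrow> 'b) \<Rightarrow> bool" where
  "order_iso X ltX Y ltY f \<longleftrightarrow>
     bij_betw f X Y \<and> (\<forall>x\<in>X. \<forall>y\<in>X. ltX x y \<longleftrightarrow> ltY (f x) (f y))"

definition copies :: "'a set \<Rightarrow> ('a \<Rightarrow> 'a \<Rightarrow> bool) \<Rightarrow> 'a set set" where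
  "copies X lt = {A. A \<subseteq> X \<and> (\<exists>f. order_iso X lt A lt f)}"

definition compatible :: "'p set \<Rightarrow> ('p \<Rightarrow> 'p \<Rightarrow> bool) \<Rightarrow> 'p \<Rightarrow> 'p \<Rightarrow> bool" where
  "compatible P le a b \<longleftrightarrow> (\<exists>c\<in>P. le c a \<and> le c b)"

definition antichain :: "'p set \<Rightarrow> ('p \<Rightarrow> 'p \<Rightarrow> bool) \<Rightarrow> 'p set \<Rightarrow> bool" where
  "antichain P le \<A> \<longleftrightarrow> \<A> \<subseteq> P \<and> pairwise (\<lambda>a b. \<not> compatible P le a b) \<A>"

definition maximal_antichain :: "'p set \<Rightarrow> ('p \<Rightarrow> 'p \<Rightarrow> bool) \<Rightarrow> 'p set \<Rightarrow> bool" where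
  "maximal_antichain P le \<A> \<longleftrightarrow>
     antichain P le \<A> \<and> (\<forall>p\<in>P. \<exists>a\<in>\<A>. compatible P le p a)"

text \<open>The ordinal \<open>n \<le> \<omega>\<close> as the set of its predecessors, with \<open>\<infinity> :: enat\<close> playing
  the role of \<open>\<omega>\<close>.\<close>

definition ordinal_set :: "enat \<Rightarrow> nat set" where
  "ordinal_set n = {i. enat i < n}"

definition C_dom :: "enat \<Rightarrow> (nat \<times> rat) set" where
  "C_dom n = ordinal_set n \<times> UNIV"

definition C_less :: "nat \<times> rat \<Rightarrow> nat \<times> rat \<Rightarrow> bool" where
  "C_less x y \<longleftrightarrow> snd x < snd y"

definition P_Q :: "rat set set" where
  "P_Q = copies UNIV (<)"

definition P_C :: "enat \<Rightarrow> (nat \<times> rat) set set" where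
  "P_C n = copies (C_dom n) C_less"

end

theory Submission
  imports Defs
begin

text \<open>
  The order on a copy of \<open>C\<^sub>n\<close> recovers its second coordinates up to order isomorphism, because two
  points are incomparable iff they have the same second coordinate. So projection maps copies of
  \<open>C\<^sub>n\<close> to copies of \<open>\<rat>\<close>, and conversely a copy of \<open>\<rat>\<close> inside the projection of a copy \<open>X\<close>
  lifts to a copy of \<open>C\<^sub>n\<close> inside \<open>X\<close>; this transfers compatibility in both directions and reduces
  everything to \<open>\<rat>\<close>.

  In \<open>\<rat>\<close> the open intervals \<open>(k, k + 1)\<close>, \<open>k\<close> an integer, form a countable maximal antichain,
  since a copy of \<open>\<rat>\<close> has two points with the same floor. For an antichain of size continuum, take
  an almost disjoint family of infinite sets of naturals \<open>J\<close>, and for each of them a copy of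
  \<open>\<rat>\<close> inside the dense set of all dyadic fractions whose reduced denominator is \<open>2 ^ j\<close> with
  \<open>j \<in> J\<close>. Two such copies share only fractions of bounded denominator, and these contain no
  copy of \<open>\<rat>\<close>. Extend by Zorn's lemma.
\<close>

section \<open>Maximal antichains\<close>

lemma compatible_commute: "compatible P le a b \<longleftrightarrow> compatible P le b a"
  by (auto simp: compatible_def)

lemma antichain_imageI:
  assumes "\<And>i. i \<in> I \<Longrightarrow> F i \<in> P"
    and "\<And>i j. i \<in> I \<Longrightarrow> j \<in> I \<Longrightarrow> i \<noteq> j \<Longrightarrow> \<not> compatible P le (F i) (F j)"
  shows "antichain P le (F ` I)"
  unfolding antichain_def pairwise_image using assms by (simp add: image_subset_iff pairwise_def)

text \<open>Zorn's lemma applies because two elements of the union of a chain already lie in one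
  link. An element \<open>p\<close> incompatible with all of \<open>M\<close> would belong to
  \<open>M\<close> by maximality, yet reflexivity makes \<open>p\<close> compatible with
  itself.\<close>

lemma antichain_extends_to_maximal:
  assumes C: "antichain P le \<C>" and refl: "\<And>p. p \<in> P \<Longrightarrow> le p p"
  obtains \<A> where "maximal_antichain P le \<A>" "\<C> \<subseteq> \<A>"
proof -
  let ?S = "{\<A>. antichain P le \<A> \<and> \<C> \<subseteq> \<A>}"
  have "\<exists>M\<in>?S. \<forall>X\<in>?S. M \<subseteq> X \<longrightarrow> X = M"
  proof (rule subset_Zorn_nonempty)
    show "?S \<noteq> {}" using C by blast
    fix \<K> assume ne: "\<K> \<noteq> {}" and chain: "subset.chain ?S \<K>"
    have sub: "\<And>X. X \<in> \<K> \<Longrightarrow> antichain P le X \<and> \<C> \<subseteq> X"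
      and lin: "\<And>X Y. X \<in> \<K> \<Longrightarrow> Y \<in> \<K> \<Longrightarrow> X \<subseteq> Y \<or> Y \<subseteq> X"
      using chain by (auto simp: subset_chain_def)
    have "pairwise (\<lambda>a b. \<not> compatible P le a b) (\<Union>\<K>)"
    proof (rule pairwiseI)
      fix a b assume "a \<in> \<Union>\<K>" "b \<in> \<Union>\<K>" "a \<noteq> b"
      then obtain X where "X \<in> \<K>" "a \<in> X" "b \<in> X"
        using lin by blast
      then show "\<not> compatible P le a b"
        using sub \<open>a \<noteq> b\<close> by (auto simp: antichain_def pairwise_def)
    qed
    then show "\<Union>\<K> \<in> ?S"
      using sub ne by (auto simp: antichain_def)
  qed
  then obtain M where M: "antichain P le M" "\<C> \<subseteq> M"
    and max: "\<And>X. antichain P le X \<Longrightarrow> M \<subseteq> X \<Longrightarrow> X = M"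
    by (smt (verit) mem_Collect_eq subset_trans)
  have "\<exists>a\<in>M. compatible P le p a" if p: "p \<in> P" for p
  proof (rule ccontr)
    assume *: "\<not> ?thesis"
    then have "antichain P le (insert p M)"
      using M(1) p by (auto simp: antichain_def pairwise_insert compatible_commute[of P le p])
    then have "p \<in> M" using max by blast
    moreover have "compatible P le p p"
      using p refl by (auto simp: compatible_def)
    ultimately show False using * by blast
  qed
  then show thesis
    using M that unfolding maximal_antichain_def by blast
qed

section \<open>Copies of the rationals\<close>

lemma P_Q_iff: "A \<in> P_Q \<longleftrightarrow> (\<exists>f :: rat \<Rightarrow> rat. strict_mono f \<and> A = range f)"
proof
  assume "A \<in> P_Q"
  then show "\<exists>f :: rat \<Rightarrow> rat. strict_mono f \<and> A = range f"
    by (auto simp: P_Q_def copies_def order_iso_def bij_betw_def strict_mono_def)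
next
  assume "\<exists>f :: rat \<Rightarrow> rat. strict_mono f \<and> A = range f"
  then obtain f :: "rat \<Rightarrow> rat" where "strict_mono f" "A = range f" by blast
  then have "order_iso UNIV (<) A (<) f"
    by (simp add: order_iso_def bij_betw_def strict_mono_less strict_mono_imp_inj_on)
  then show "A \<in> P_Q" by (auto simp: P_Q_def copies_def)
qed

lemma compatible_P_QI:
  assumes "strict_mono (h :: rat \<Rightarrow> rat)" "range h \<subseteq> A" "range h \<subseteq> B"
  shows "compatible P_Q (\<subseteq>) A B"
proof -
  have "range h \<in> P_Q" using assms(1) P_Q_iff by blast
  then show ?thesis using assms(2,3) by (auto simp: compatible_def)
qed

lemma compatible_P_QE:
  assumes "compatible P_Q (\<subseteq>) A B"
  obtains h :: "rat \<Rightarrow> rat" where "strict_mono h" "range h \<subseteq> A" "range h \<subseteq> B"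
proof -
  from assms obtain C where "C \<in> P_Q" "C \<subseteq> A" "C \<subseteq> B"
    by (auto simp: compatible_def)
  then show thesis
    using that unfolding P_Q_iff by blast
qed

text \<open>The infinitely many rationals in [0, 1] would embed in a finite interval of integers.
  This obstruction is used both for floors and for fractions of bounded denominator.\<close>

lemma not_strict_mono_rat_int: "\<not> strict_mono (h :: rat \<Rightarrow> int)"
proof
  assume h: "strict_mono h"
  have "h ` {0..1} \<subseteq> {h 0..h 1}"
    using h by (auto simp: strict_mono_less_eq)
  then have "finite (h ` {0..1})"
    using finite_subset by blast
  then have "finite {0..1::rat}"
    using h by (simp add: finite_image_iff strict_mono_imp_inj_on)
  then show False
    using infinite_Icc[of "0::rat" 1] by simp
qed

text \<open>The quotient x / (1 + |x|) is an order isomorphism of the rationals onto those in (-1,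
  1); the rest rescales to (0, 1).\<close>

definition unit_map :: "rat \<Rightarrow> rat" where
  "unit_map x = (1 + x / (1 + \<bar>x\<bar>)) / 2"

lemma strict_mono_unit_map: "strict_mono unit_map"
proof (rule strict_monoI)
  fix x y :: rat assume "x < y"
  \<comment> \<open>This is the quotient inequality cross-multiplied. For equal signs x * |y| = y *
    |x|, leaving x < y; for opposite signs a negative number is compared with a positive
    one.\<close>
  have "x * (1 + \<bar>y\<bar>) < y * (1 + \<bar>x\<bar>)"
  proof (cases "x \<ge> 0 \<or> y \<le> 0")
    case True
    then show ?thesis using \<open>x < y\<close> by (auto simp: algebra_simps abs_if)
  next
    case False
    then have "x * (1 + \<bar>y\<bar>) < 0" "0 < y * (1 + \<bar>x\<bar>)"
      by (auto simp: mult_less_0_iff zero_less_mult_iff)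
    then show ?thesis by linarith
  qed
  then have "x / (1 + \<bar>x\<bar>) < y / (1 + \<bar>y\<bar>)"
    by (simp add: pos_divide_less_eq pos_less_divide_eq add_pos_nonneg)
  then show "unit_map x < unit_map y"
    unfolding unit_map_def by (intro divide_strict_right_mono add_strict_left_mono) auto
qed

lemma range_unit_map: "range unit_map = {0<..<1}"
proof
  show "range unit_map \<subseteq> {0<..<1}"
  proof
    fix z assume "z \<in> range unit_map"
    then obtain x where z: "z = unit_map x" by blast
    have "- 1 < x / (1 + \<bar>x\<bar>)" "x / (1 + \<bar>x\<bar>) < 1"
      by (auto simp: divide_less_eq less_divide_eq)
    then show "z \<in> {0<..<1}"
      by (auto simp: z unit_map_def)
  qed
  show "{0<..<1} \<subseteq> range unit_map"
  proof
    fix z :: rat assume z: "z \<in> {0<..<1}"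
    define y where "y = 2 * z - 1"
    have y: "\<bar>y\<bar> < 1" using z by (auto simp: y_def abs_if)
    \<comment> \<open>The point y / (1 - |y|) solves t / (1 + |t|) = y for t.\<close>
    have "1 + \<bar>y / (1 - \<bar>y\<bar>)\<bar> = 1 / (1 - \<bar>y\<bar>)"
      using y by (simp add: field_simps)
    then have "unit_map (y / (1 - \<bar>y\<bar>)) = (1 + y) / 2"
      using y by (simp add: unit_map_def)
    also have "\<dots> = z" by (simp add: y_def)
    finally show "z \<in> range unit_map" by (metis rangeI)
  qed
qed

lemma open_interval_in_P_Q:
  assumes "a < b"
  shows "{a<..<b} \<in> P_Q"
proof -
  have "strict_mono (\<lambda>x. a + (b - a) * unit_map x)"
    using assms strict_mono_unit_map by (simp add: strict_mono_def)
  moreover have "range (\<lambda>x. a + (b - a) * unit_map x) = {a<..<b}"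
  proof -
    have "z \<in> (\<lambda>u. a + (b - a) * u) ` {0<..<1}" if "a < z" "z < b" for z
      by (rule image_eqI[of _ _ "(z - a) / (b - a)"]) (use that in \<open>auto simp: field_simps\<close>)
    moreover have "a + (b - a) * u < b" if "0 < u" "u < 1" for u
    proof -
      have "(b - a) * u < (b - a) * 1"
        using that assms by (intro mult_strict_left_mono) auto
      then show ?thesis by simp
    qed
    ultimately have "(\<lambda>u. a + (b - a) * u) ` {0<..<1} = {a<..<b}"
      using assms by auto
    then show ?thesis
      by (metis range_unit_map image_image)
  qed
  ultimately show ?thesis
    by (metis P_Q_iff)
qed

lemma maximal_antichain_unit_intervals:
  "maximal_antichain P_Q (\<subseteq>) (range (\<lambda>k::int. {of_int k<..<of_int k + 1}))"
proof -
  have "antichain P_Q (\<subseteq>) (range (\<lambda>k::int. {of_int k<..<of_int k + 1}))"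
  proof (rule antichain_imageI)
    show "{of_int k<..<of_int k + 1} \<in> P_Q" for k :: int
      by (rule open_interval_in_P_Q) simp
    show "\<not> compatible P_Q (\<subseteq>) {of_int k<..<of_int k + 1} {of_int l<..<of_int l + 1}"
      if "k \<noteq> l" for k l :: int
    proof
      assume "compatible P_Q (\<subseteq>) {of_int k<..<of_int k + 1} {of_int l<..<of_int l + 1}"
      then obtain h :: "rat \<Rightarrow> rat" where "range h \<subseteq> {of_int k<..<of_int k + 1}"
        "range h \<subseteq> {of_int l<..<of_int l + 1}"
        by (rule compatible_P_QE)
      then have "h 0 \<in> {of_int k<..<of_int k + 1}" "h 0 \<in> {of_int l<..<of_int l + 1}"
        by blast+
      then have "\<lfloor>h 0\<rfloor> = k" "\<lfloor>h 0\<rfloor> = l"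
        by (auto simp: floor_eq_iff)
      then show False using that by simp
    qed
  qed
  moreover have "\<exists>k::int. compatible P_Q (\<subseteq>) A {of_int k<..<of_int k + 1}" if "A \<in> P_Q" for A
  proof -
    from that obtain f :: "rat \<Rightarrow> rat" where f: "strict_mono f" and A: "A = range f"
      by (auto simp: P_Q_iff)
    \<comment> \<open>Otherwise the floor of \<open>f\<close> would be a strictly monotone map from
      the rationals to the integers.\<close>
    obtain x y where "x < y" and "\<not> \<lfloor>f x\<rfloor> < \<lfloor>f y\<rfloor>"
      using not_strict_mono_rat_int[of "\<lambda>x. \<lfloor>f x\<rfloor>"] by (auto simp: strict_mono_def)
    then have eq: "\<lfloor>f x\<rfloor> = \<lfloor>f y\<rfloor>"
      using f by (meson antisym_conv2 floor_mono less_imp_le strict_mono_less)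
    \<comment> \<open>Only arguments strictly between \<open>x\<close> and \<open>y\<close> are
      kept, since \<open>f x\<close> may itself be the integer endpoint excluded from the
      interval.\<close>
    obtain g :: "rat \<Rightarrow> rat" where g: "strict_mono g" "range g = {x<..<y}"
      using open_interval_in_P_Q[OF \<open>x < y\<close>] by (auto simp: P_Q_iff)
    have "f (g z) \<in> {of_int \<lfloor>f x\<rfloor><..<of_int \<lfloor>f x\<rfloor> + 1}" for z
    proof -
      have "x < g z" "g z < y" using g(2) by auto
      then have "f x < f (g z)" "f (g z) < f y"
        using f by (auto simp: strict_mono_less)
      moreover have "of_int \<lfloor>f x\<rfloor> \<le> f x" "f y < of_int \<lfloor>f x\<rfloor> + 1"
        using eq by linarith+
      ultimately show ?thesis unfolding greaterThanLessThan_iff by linarith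
    qed
    then show ?thesis
      using f g(1) by (intro exI[of _ "\<lfloor>f x\<rfloor>"] compatible_P_QI[of "f \<circ> g"])
        (auto simp: A strict_mono_o)
  qed
  ultimately show ?thesis
    unfolding maximal_antichain_def by blast
qed

lemma inj_unit_intervals: "inj (\<lambda>k::int. {of_int k<..<of_int k + (1::rat)})"
proof (rule injI)
  fix k l :: int
  assume eq: "{of_int k<..<of_int k + (1::rat)} = {of_int l<..<of_int l + 1}"
  have "of_int k + 1 / 2 \<in> {of_int k<..<of_int k + (1::rat)}" by simp
  then have "of_int k + 1 / 2 \<in> {of_int l<..<of_int l + (1::rat)}" unfolding eq .
  then have "(of_int l :: rat) < of_int (k + 1)" "(of_int k :: rat) < of_int (l + 1)"
    by auto
  then show "k = l" unfolding of_int_less_iff by linarith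
qed

section \<open>An antichain of size continuum\<close>

text \<open>Supplies the gap for the next value in the forth construction. An empty side occurs when
  the new rational lies beyond all earlier ones.\<close>

lemma finite_sets_separated:
  fixes L U :: "rat set"
  assumes "finite L" "finite U" and lt: "\<And>l u. l \<in> L \<Longrightarrow> u \<in> U \<Longrightarrow> l < u"
  obtains a b where "a < b" "\<And>l. l \<in> L \<Longrightarrow> l \<le> a" "\<And>u. u \<in> U \<Longrightarrow> b \<le> u"
proof (cases "U = {}")
  case True
  obtain a where "\<And>l. l \<in> L \<Longrightarrow> l \<le> a"
    using assms(1) by (meson Max_ge)
  then show thesis using True by (intro that[of a "a + 1"]) auto
next
  case U: False
  show thesis
  proof (cases "L = {}")
    case True
    then show thesis
      using assms(2) by (intro that[of "Min U - 1" "Min U"]) auto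
  next
    case False
    then show thesis
      using U assms by (intro that[of "Max L" "Min U"]) auto
  qed
qed

text \<open>The ``forth'' half of Cantor's back-and-forth argument.\<close>

lemma strict_mono_into_dense:
  fixes D :: "rat set"
  assumes dense: "\<And>a b. a < b \<Longrightarrow> \<exists>d\<in>D. a < d \<and> d < b"
  obtains f :: "rat \<Rightarrow> rat" where "strict_mono f" "range f \<subseteq> D"
proof -
  \<comment> \<open>\<open>P g m r\<close> says that \<open>r\<close> is an admissible value at
    index \<open>m\<close>, given \<open>g\<close> below \<open>m\<close>. The enumeration may
    repeat a rational; repetitions do not constrain each other, and \<open>inv\<close> later selects
    one index per rational.\<close>
  define P :: "(nat \<Rightarrow> rat) \<Rightarrow> nat \<Rightarrow> rat \<Rightarrow> bool" where
    "P g m r \<longleftrightarrow> r \<in> D \<and> (\<forall>i<m. (nat_to_rat_surj i < nat_to_rat_surj m \<longrightarrow> g i < r) \<and>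
       (nat_to_rat_surj m < nat_to_rat_surj i \<longrightarrow> r < g i))" for g m r
  let ?e = nat_to_rat_surj
  \<comment> \<open>The constraint is enforced by whichever of the two indices comes later.\<close>
  have mono: "g i < g j" if "\<And>i. i < m \<Longrightarrow> P g i (g i)" "i < m" "j < m" "?e i < ?e j" for g m i j
    using that by (cases i j rule: linorder_cases) (auto simp: P_def)
  have "\<exists>g. \<forall>m. P g m (g m)"
  proof (rule dependent_wellorder_choice)
    show "P f m r = P g m r" if "\<And>i. i < m \<Longrightarrow> f i = g i" for r f g m
      using that by (auto simp: P_def)
    show "\<exists>r. P g m r" if *: "\<And>i. i < m \<Longrightarrow> P g i (g i)" for m g
    proof -
      let ?L = "g ` {i. i < m \<and> ?e i < ?e m}" and ?U = "g ` {i. i < m \<and> ?e m < ?e i}"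
      have lt: "l < u" if LU: "l \<in> ?L" "u \<in> ?U" for l u
      proof -
        obtain i j where "l = g i" "u = g j" "i < m" "j < m" "?e i < ?e m" "?e m < ?e j"
          using LU by blast
        then show ?thesis using mono[OF *] less_trans by blast
      qed
      have "finite ?L" "finite ?U" by simp_all
      then obtain a b where "a < b" and ab: "\<And>l. l \<in> ?L \<Longrightarrow> l \<le> a" "\<And>u. u \<in> ?U \<Longrightarrow> b \<le> u"
        using finite_sets_separated[OF _ _ lt] by blast
      obtain d where d: "d \<in> D" "a < d" "d < b" using dense[OF \<open>a < b\<close>] by blast
      have "g i < d" if "i < m" "?e i < ?e m" for i
        using ab(1)[of "g i"] that d(2) by simp
      moreover have "d < g i" if "i < m" "?e m < ?e i" for i
        using ab(2)[of "g i"] that d(3) by simp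
      ultimately have "P g m d"
        using d(1) by (simp add: P_def)
      then show ?thesis ..
    qed
  qed
  then obtain g where g: "\<And>m. P g m (g m)" by blast
  have "strict_mono (\<lambda>q. g (inv ?e q))"
  proof (rule strict_monoI)
    fix x y :: rat assume "x < y"
    let ?i = "inv ?e x" and ?j = "inv ?e y"
    have "?e ?i < ?e ?j" using \<open>x < y\<close> by (simp add: surj_f_inv_f surj_nat_to_rat_surj)
    then show "g ?i < g ?j"
      using mono[of "Suc (max ?i ?j)" g ?i ?j] g by simp
  qed
  moreover have "range (\<lambda>q. g (inv ?e q)) \<subseteq> D" using g by (auto simp: P_def)
  ultimately show thesis by (rule that)
qed

text \<open>The odd numerator keeps the fraction reduced, so its value determines
  \<open>j\<close>.\<close>

definition dyadics :: "nat set \<Rightarrow> rat set" where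
  "dyadics J = {of_int (2 * k + 1) / 2 ^ j | k j. j \<in> J}"

text \<open>Consecutive odd integers are 2 apart, so one lies strictly between a * 2^j and b * 2^j
  once (b - a) * 2^j > 2; an infinite \<open>J\<close> contains such a \<open>j\<close>.\<close>

lemma dyadics_dense:
  assumes "infinite J" "a < b"
  shows "\<exists>d\<in>dyadics J. a < d \<and> d < b"
proof -
  obtain m :: nat where m: "2 / (b - a) < of_nat m"
    using reals_Archimedean2 by blast
  obtain j where j: "j \<in> J" "m < j"
    using assms(1) by (meson infinite_nat_iff_unbounded)
  have "(of_nat m :: rat) \<le> of_nat (2 ^ j)"
    using j(2) less_exp[of j] unfolding of_nat_le_iff by linarith
  then have "2 / (b - a) < 2 ^ j" using m by (simp only: of_nat_power of_nat_numeral)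
  then have big: "2 < (b - a) * 2 ^ j"
    using assms(2) by (simp add: divide_less_eq mult.commute)
  \<comment> \<open>This makes 2 * k + 1 the least odd integer above a * 2^j.\<close>
  define k where "k = \<lfloor>(a * 2 ^ j + 1) / 2\<rfloor>"
  have "of_int k \<le> (a * 2 ^ j + 1) / 2" "(a * 2 ^ j + 1) / 2 < of_int k + 1"
    unfolding k_def by linarith+
  then have "a * 2 ^ j < of_int (2 * k + 1)" "of_int (2 * k + 1) < b * 2 ^ j"
    using big by (auto simp: algebra_simps)
  then have "a < of_int (2 * k + 1) / 2 ^ j" "of_int (2 * k + 1) / 2 ^ j < b"
    by (auto simp: less_divide_eq divide_less_eq)
  then show ?thesis
    using j(1) by (auto simp: dyadics_def)
qed

text \<open>If j > i, clearing denominators would write an odd integer as an even one. Used in both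
  directions, it gives equal exponents.\<close>

lemma odd_dyadic_exponent_le:
  assumes "of_int (2 * k + 1) / 2 ^ i = (of_int (2 * l + 1) / 2 ^ j :: rat)"
  shows "j \<le> i"
proof (rule ccontr)
  assume "\<not> j \<le> i"
  then obtain d where j: "j = Suc (i + d)" by (metis less_iff_Suc_add not_le)
  have "(of_int (2 * k + 1) * 2 ^ j :: rat) = of_int (2 * l + 1) * 2 ^ i"
    using assms by (simp add: divide_simps)
  then have "of_int ((2 * k + 1) * (2 * 2 ^ d)) = (of_int (2 * l + 1) :: rat)"
    by (simp add: j power_add)
  then have "(2 * k + 1) * (2 * 2 ^ d) = 2 * l + 1"
    by (simp only: of_int_eq_iff)
  then have "even (2 * l + 1)"
    by (metis dvd_mult dvd_triv_left)
  then show False by simp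
qed

lemma dyadics_inter: "dyadics I \<inter> dyadics J \<subseteq> dyadics (I \<inter> J)"
proof
  fix x assume "x \<in> dyadics I \<inter> dyadics J"
  then obtain k l i j where x: "x = of_int (2 * k + 1) / 2 ^ i" "x = of_int (2 * l + 1) / 2 ^ j"
    and "i \<in> I" "j \<in> J"
    unfolding dyadics_def by blast
  then have "i = j"
    by (metis odd_dyadic_exponent_le le_antisym)
  with x \<open>i \<in> I\<close> \<open>j \<in> J\<close> show "x \<in> dyadics (I \<inter> J)"
    unfolding dyadics_def by blast
qed

text \<open>Multiplying by 2^m, with \<open>m\<close> an upper bound of \<open>J\<close>, would turn
  \<open>h\<close> into a strictly monotone integer-valued map.\<close>

lemma no_copy_in_finite_dyadics:
  assumes "finite J" "strict_mono (h :: rat \<Rightarrow> rat)" "range h \<subseteq> dyadics J"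
  shows False
proof -
  obtain m where m: "\<And>j. j \<in> J \<Longrightarrow> j \<le> m"
    using assms(1) by (meson Max_ge)
  have int: "of_int \<lfloor>h x * 2 ^ m\<rfloor> = h x * 2 ^ m" for x
  proof -
    have "h x \<in> dyadics J" using assms(3) by blast
    then obtain k j where h: "h x = of_int (2 * k + 1) / 2 ^ j" and "j \<in> J"
      by (auto simp: dyadics_def)
    obtain d where "m = j + d" using m[OF \<open>j \<in> J\<close>] le_Suc_ex by blast
    then have "h x * 2 ^ m = of_int ((2 * k + 1) * 2 ^ d)"
      by (simp add: h power_add)
    then show ?thesis by (metis floor_of_int)
  qed
  have "strict_mono (\<lambda>x. \<lfloor>h x * 2 ^ m\<rfloor>)"
  proof (rule strict_monoI)
    fix x y :: rat assume "x < y"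
    then have "h x * 2 ^ m < h y * 2 ^ m" using assms(2) by (simp add: strict_mono_less)
    then have "(of_int \<lfloor>h x * 2 ^ m\<rfloor> :: rat) < of_int \<lfloor>h y * 2 ^ m\<rfloor>" by (simp only: int)
    then show "\<lfloor>h x * 2 ^ m\<rfloor> < \<lfloor>h y * 2 ^ m\<rfloor>" by (simp only: of_int_less_iff)
  qed
  then show False by (simp add: not_strict_mono_rat_int)
qed

text \<open>The branch of \<open>S\<close> in the binary tree, with nodes coded as numbers. Storing
  the length \<open>m\<close> makes all nodes of a branch distinct.\<close>

definition initial_codes :: "nat set \<Rightarrow> nat set" where
  "initial_codes S = range (\<lambda>m. prod_encode (m, set_encode (S \<inter> {..<m})))"

lemma infinite_initial_codes: "infinite (initial_codes S)"
  unfolding initial_codes_def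
  by (rule range_inj_infinite) (auto simp: inj_def)

text \<open>A common code has the same length \<open>m\<close> for both sets, so they agree below
  \<open>m\<close>, and \<open>m\<close> cannot exceed a point \<open>s\<close> where they
  differ.\<close>

lemma initial_codes_almost_disjoint:
  assumes "S \<noteq> T"
  shows "finite (initial_codes S \<inter> initial_codes T)"
proof -
  obtain s where s: "s \<in> S \<longleftrightarrow> s \<notin> T" using assms by blast
  have "initial_codes S \<inter> initial_codes T
      \<subseteq> (\<lambda>m. prod_encode (m, set_encode (S \<inter> {..<m}))) ` {..s}"
  proof
    fix c assume "c \<in> initial_codes S \<inter> initial_codes T"
    then obtain m where c: "c = prod_encode (m, set_encode (S \<inter> {..<m}))"
      and "set_encode (S \<inter> {..<m}) = set_encode (T \<inter> {..<m})"
      by (auto simp: initial_codes_def)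
    then have "S \<inter> {..<m} = T \<inter> {..<m}"
      by (simp add: set_encode_eq)
    then have "m \<le> s" using s by (metis IntD1 IntI lessThan_iff not_le)
    with c show "c \<in> (\<lambda>m. prod_encode (m, set_encode (S \<inter> {..<m}))) ` {..s}" by blast
  qed
  then show ?thesis using finite_subset by blast
qed

lemma maximal_antichain_continuum:
  obtains \<A> where "maximal_antichain P_Q (\<subseteq>) \<A>" "\<A> \<approx> (UNIV :: nat set set)"
proof -
  have "\<exists>f :: rat \<Rightarrow> rat. strict_mono f \<and> range f \<subseteq> dyadics (initial_codes S)" for S
    using strict_mono_into_dense dyadics_dense[OF infinite_initial_codes] by metis
  then obtain F :: "nat set \<Rightarrow> rat \<Rightarrow> rat"
    where mono: "\<And>S. strict_mono (F S)" and sub: "\<And>S. range (F S) \<subseteq> dyadics (initial_codes S)"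
    by metis
  have incompatible: "\<not> compatible P_Q (\<subseteq>) (range (F S)) (range (F T))" if "S \<noteq> T" for S T
  proof
    assume "compatible P_Q (\<subseteq>) (range (F S)) (range (F T))"
    then obtain h :: "rat \<Rightarrow> rat" where h: "strict_mono h"
      "range h \<subseteq> range (F S)" "range h \<subseteq> range (F T)"
      by (rule compatible_P_QE)
    then have "range h \<subseteq> dyadics (initial_codes S) \<inter> dyadics (initial_codes T)"
      using sub[of S] sub[of T] by (meson Int_greatest subset_trans)
    then have "range h \<subseteq> dyadics (initial_codes S \<inter> initial_codes T)"
      using dyadics_inter by (rule subset_trans)
    then show False
      by (rule no_copy_in_finite_dyadics[OF initial_codes_almost_disjoint[OF that] h(1)])
  qed
  \<comment> \<open>A copy is compatible with itself, so incompatibility for distinct indices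
    already makes the copies distinct.\<close>
  have inj: "inj (\<lambda>S. range (F S))"
  proof (rule injI)
    fix S T assume "range (F S) = range (F T)"
    then have "compatible P_Q (\<subseteq>) (range (F S)) (range (F T))"
      using mono[of S] compatible_P_QI[of "F S"] by simp
    then show "S = T" using incompatible by blast
  qed
  have "antichain P_Q (\<subseteq>) (range (\<lambda>S. range (F S)))"
    using incompatible mono by (intro antichain_imageI) (auto simp: P_Q_iff)
  then obtain \<A> where \<A>: "maximal_antichain P_Q (\<subseteq>) \<A>" and "range (\<lambda>S. range (F S)) \<subseteq> \<A>"
    by (rule antichain_extends_to_maximal) auto
  then have "(UNIV :: nat set set) \<lesssim> \<A>"
    using inj by (auto simp: lepoll_def)
  \<comment> \<open>Any family of sets of rationals is this small, so the uncontrolled Zorn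
    extension cannot exceed the continuum.\<close>
  moreover have "\<A> \<lesssim> (UNIV :: nat set set)"
    unfolding lepoll_def
    by (rule exI[of _ "image to_nat"]) (simp add: inj_on_def inj_image_eq_iff)
  ultimately show thesis
    using \<A> that lepoll_antisym by blast
qed

section \<open>Transfer between the rationals and the product\<close>

lemma ordinal_set_nonempty: "1 \<le> n \<Longrightarrow> 0 \<in> ordinal_set n"
  by (auto simp: ordinal_set_def zero_enat_def[symmetric] zero_less_iff_neq_zero)

lemma times_in_P_C:
  assumes "A \<in> P_Q"
  shows "ordinal_set n \<times> A \<in> P_C n"
proof -
  obtain f :: "rat \<Rightarrow> rat" where f: "strict_mono f" "A = range f"
    using assms by (auto simp: P_Q_iff)
  then have "map_prod id f ` C_dom n = ordinal_set n \<times> A"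
    by (simp add: C_dom_def map_prod_surj_on)
  then have "order_iso (C_dom n) C_less (ordinal_set n \<times> A) C_less (map_prod id f)"
    using f(1) by (auto simp: order_iso_def bij_betw_def C_less_def strict_mono_less
        strict_mono_eq inj_on_def)
  then show ?thesis by (auto simp: P_C_def copies_def C_dom_def)
qed

text \<open>The points (i, q) and (0, q) are incomparable, hence so are their images under
  \<open>f\<close>, which therefore share their second coordinate. This makes that coordinate a
  function \<open>h\<close> of q alone.\<close>

lemma P_C_sections:
  assumes "1 \<le> n" "X \<in> P_C n"
  obtains f h where "order_iso (C_dom n) C_less X C_less f" "strict_mono h"
    "\<forall>i\<in>ordinal_set n. \<forall>q. snd (f (i, q)) = h q" "snd ` X = range h"
proof -
  obtain f where f: "order_iso (C_dom n) C_less X C_less f"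
    using assms(2) by (auto simp: P_C_def copies_def)
  define h where "h q = snd (f (0, q))" for q
  have less: "snd (f (i, q)) < snd (f (j, r)) \<longleftrightarrow> q < r"
    if "i \<in> ordinal_set n" "j \<in> ordinal_set n" for i j q r
  proof -
    have "C_less (i, q) (j, r) \<longleftrightarrow> C_less (f (i, q)) (f (j, r))"
      using f that unfolding order_iso_def C_dom_def by blast
    then show ?thesis by (simp add: C_less_def)
  qed
  note 0 = ordinal_set_nonempty[OF assms(1)]
  have h: "snd (f (i, q)) = h q" if "i \<in> ordinal_set n" for i q
    using less[OF that 0, of q q] less[OF 0 that, of q q] by (simp add: h_def not_less)
  have "X = f ` C_dom n" using f by (simp add: order_iso_def bij_betw_def)
  then have X: "snd ` X = (\<lambda>x. snd (f x)) ` C_dom n" by (simp add: image_image)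
  have "snd ` X = range h"
  proof
    show "snd ` X \<subseteq> range h" unfolding X by (auto simp: C_dom_def h)
    show "range h \<subseteq> snd ` X"
      unfolding X h_def by (rule image_subsetI, rule image_eqI, rule refl) (simp add: C_dom_def 0)
  qed
  moreover have "strict_mono h"
    using less[OF 0 0] by (auto simp: strict_mono_def h_def)
  ultimately show thesis
    by (intro that[OF f]) (simp_all add: h)
qed

lemma snd_image_in_P_Q: "1 \<le> n \<Longrightarrow> X \<in> P_C n \<Longrightarrow> snd ` X \<in> P_Q"
  unfolding P_Q_iff by (erule P_C_sections) blast+

text \<open>Since \<open>B\<close> lies in the range of \<open>h\<close>, its parametrization
  factors as k = h o s. Precomposing \<open>f\<close> with \<open>s\<close> on second coordinates
  selects the part of \<open>X\<close> indexed by the range of \<open>s\<close>, whose second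
  coordinates are h (s q) = k q.\<close>

lemma P_C_restrict:
  assumes "1 \<le> n" "X \<in> P_C n" "B \<in> P_Q" "B \<subseteq> snd ` X"
  obtains Y where "Y \<in> P_C n" "Y \<subseteq> X" "snd ` Y \<subseteq> B"
proof -
  obtain f h where f: "order_iso (C_dom n) C_less X C_less f" and h: "strict_mono h"
    and fh: "\<forall>i\<in>ordinal_set n. \<forall>q. snd (f (i, q)) = h q" and X: "snd ` X = range h"
    using assms(1,2) by (rule P_C_sections)
  obtain k :: "rat \<Rightarrow> rat" where k: "strict_mono k" "B = range k"
    using assms(3) by (auto simp: P_Q_iff)
  have "\<exists>s. k q = h s" for q
  proof -
    have "k q \<in> range h" using assms(4) k(2) X by blast
    then show ?thesis by blast
  qed
  then obtain s where s: "\<And>q. k q = h (s q)" by metis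
  \<comment> \<open>\<open>s\<close> inherits monotonicity from \<open>k\<close> because
    \<open>h\<close> reflects the order.\<close>
  have s_mono: "strict_mono s"
    using k(1) h by (simp add: strict_mono_def s) (metis h strict_mono_less)
  have inj: "inj_on f (C_dom n)" and image: "f ` C_dom n = X"
    using f by (simp_all add: order_iso_def bij_betw_def)
  let ?g = "f \<circ> map_prod id s"
  have dom: "map_prod id s ` C_dom n \<subseteq> C_dom n" by (auto simp: C_dom_def)
  have sub: "?g ` C_dom n \<subseteq> X"
    using dom image by (metis image_comp image_mono)
  have "inj_on ?g (C_dom n)"
  proof (rule comp_inj_on)
    show "inj_on (map_prod id s) (C_dom n)"
      using s_mono by (auto simp: inj_on_def strict_mono_eq)
    show "inj_on f (map_prod id s ` C_dom n)"
      using inj dom by (rule inj_on_subset)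
  qed
  then have "order_iso (C_dom n) C_less (?g ` C_dom n) C_less ?g"
    using s_mono h by (auto simp: order_iso_def bij_betw_def C_dom_def C_less_def fh
        strict_mono_less)
  moreover have "X \<subseteq> C_dom n" using assms(2) by (auto simp: P_C_def copies_def)
  ultimately have "?g ` C_dom n \<in> P_C n"
    using sub unfolding P_C_def copies_def by blast
  moreover have "snd ` ?g ` C_dom n \<subseteq> B"
    by (auto simp: C_dom_def fh k(2) s[symmetric])
  ultimately show thesis using sub that by blast
qed

lemma maximal_antichain_times:
  assumes n: "1 \<le> n" and \<A>: "maximal_antichain P_Q (\<subseteq>) \<A>"
  shows "maximal_antichain (P_C n) (\<subseteq>) {ordinal_set n \<times> A | A. A \<in> \<A>}"
proof -
  have sub: "\<A> \<subseteq> P_Q" and incompatible: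
    "\<And>A B. A \<in> \<A> \<Longrightarrow> B \<in> \<A> \<Longrightarrow> A \<noteq> B \<Longrightarrow> \<not> compatible P_Q (\<subseteq>) A B"
    and max: "\<And>B. B \<in> P_Q \<Longrightarrow> \<exists>A\<in>\<A>. compatible P_Q (\<subseteq>) B A"
    using \<A> by (auto simp: maximal_antichain_def antichain_def pairwise_def)
  have "\<not> compatible (P_C n) (\<subseteq>) (ordinal_set n \<times> A) (ordinal_set n \<times> B)"
    if AB: "A \<in> \<A>" "B \<in> \<A>" "A \<noteq> B" for A B
  proof
    assume "compatible (P_C n) (\<subseteq>) (ordinal_set n \<times> A) (ordinal_set n \<times> B)"
    then obtain Z where "Z \<in> P_C n" "Z \<subseteq> ordinal_set n \<times> A" "Z \<subseteq> ordinal_set n \<times> B"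
      by (auto simp: compatible_def)
    then have "snd ` Z \<in> P_Q" "snd ` Z \<subseteq> A" "snd ` Z \<subseteq> B"
      using snd_image_in_P_Q[OF n] by auto
    then show False
      using incompatible[OF AB] by (auto simp: compatible_def)
  qed
  moreover have "\<exists>A\<in>\<A>. compatible (P_C n) (\<subseteq>) X (ordinal_set n \<times> A)" if X: "X \<in> P_C n" for X
  proof -
    obtain A B where A: "A \<in> \<A>" and B: "B \<in> P_Q" "B \<subseteq> snd ` X" "B \<subseteq> A"
      using max[OF snd_image_in_P_Q[OF n X]] by (auto simp: compatible_def)
    obtain Y where Y: "Y \<in> P_C n" "Y \<subseteq> X" "snd ` Y \<subseteq> B"
      using P_C_restrict[OF n X B(1,2)] .
    have "X \<subseteq> C_dom n" using X by (auto simp: P_C_def copies_def)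
    then have "Y \<subseteq> ordinal_set n \<times> A"
      using Y(2,3) B(3) by (force simp: C_dom_def)
    then show ?thesis using A Y by (auto simp: compatible_def)
  qed
  moreover have "ordinal_set n \<times> A \<in> P_C n" if "A \<in> \<A>" for A
    using that times_in_P_C sub by blast
  ultimately show ?thesis
    unfolding maximal_antichain_def Setcompr_eq_image by (simp add: antichain_imageI)
qed

text \<open>As \<open>ordinal_set n\<close> is nonempty, the product determines its factor
  \<open>A\<close>.\<close>

lemma eqpoll_times:
  assumes "1 \<le> n"
  shows "\<A> \<approx> {ordinal_set n \<times> A | A. A \<in> \<A>}"
proof -
  have "inj_on (\<lambda>A. ordinal_set n \<times> A) \<A>"
    using ordinal_set_nonempty[OF assms] by (auto simp: inj_on_def times_eq_iff)
  then have "(\<lambda>A. ordinal_set n \<times> A) ` \<A> \<approx> \<A>"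
    by (rule inj_on_image_eqpoll_self)
  then show ?thesis
    by (metis Setcompr_eq_image eqpoll_sym)
qed

theorem theorem5p4:
  fixes n :: enat
  assumes "1 \<le> n"
  shows "(\<forall>\<A>. maximal_antichain P_Q (\<subseteq>) \<A> \<longrightarrow>
            maximal_antichain (P_C n) (\<subseteq>) {ordinal_set n \<times> A | A. A \<in> \<A>} \<and>
            \<A> \<approx> {ordinal_set n \<times> A | A. A \<in> \<A>})
       \<and> (\<exists>\<A>. maximal_antichain (P_C n) (\<subseteq>) \<A> \<and> \<A> \<approx> (UNIV :: nat set))
       \<and> (\<exists>\<A>. maximal_antichain (P_C n) (\<subseteq>) \<A> \<and> \<A> \<approx> (UNIV :: nat set set))"
proof -
  have transfer: "\<exists>\<B>. maximal_antichain (P_C n) (\<subseteq>) \<B> \<and> \<B> \<approx> K"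
    if "maximal_antichain P_Q (\<subseteq>) \<A>" "\<A> \<approx> K" for \<A> and K :: "'k set"
    using maximal_antichain_times[OF assms that(1)] eqpoll_times[OF assms, of \<A>] that(2)
    by (meson eqpoll_sym eqpoll_trans)
  let ?I = "\<lambda>k::int. {of_int k<..<of_int k + (1::rat)}"
  have "range ?I \<approx> (UNIV :: int set)"
    using inj_unit_intervals by (rule inj_on_image_eqpoll_self)
  also have "(UNIV :: int set) \<approx> (UNIV :: nat set)"
    using bij_int_encode unfolding eqpoll_def by blast
  finally have "range ?I \<approx> (UNIV :: nat set)" .
  then have "\<exists>\<B>. maximal_antichain (P_C n) (\<subseteq>) \<B> \<and> \<B> \<approx> (UNIV :: nat set)"
    using transfer maximal_antichain_unit_intervals by blast
  moreover obtain \<A> where "maximal_antichain P_Q (\<subseteq>) \<A>" "\<A> \<approx> (UNIV :: nat set set)"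
    by (rule maximal_antichain_continuum)
  then have "\<exists>\<B>. maximal_antichain (P_C n) (\<subseteq>) \<B> \<and> \<B> \<approx> (UNIV :: nat set set)"
    by (rule transfer)
  ultimately show ?thesis
    using maximal_antichain_times[OF assms] eqpoll_times[OF assms] by blast
qed

end
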